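(* Let $T$ be a starlike tree with vertices $v_1,\dots,v_n$, where $v_1$ is the central vertex. Let $\lambda_{n-1}$ be the largest eigenvalue of the graph Laplacian $L(T)$, and let $\boldsymbol{\phi}_{n-1}=(\phi_{1,n-1},\dots,\phi_{n,n-1})^{\mathsf T}$ be an eigenvector corresponding to $\lambda_{n-1}$, where $\phi_{j,n-1}$ is its value at the vertex $v_j$. Then $$|\phi_{1,n-1}|>|\phi_{j,n-1}|,\qquad j=2,\dots,n.$$
   Context: For a finite simple unweighted undirected graph $G$ with vertices $v_1,\dots,v_n$, the graph Laplacian is $L(G)=D(G)-A(G)$, where $D(G)=\operatorname{diag}(d(v_1),\dots,d(v_n))$ is the diagonal matrix of vertex degrees and $A(G)=(a_{ij})$ is the adjacency matrix ($a_{ij}=1$ if $v_i,v_j$ are adjacent, and $0$ otherwise). Its eigenvalues are ordered $0=\lambda_0\le\lambda_1\le\cdots\le\lambda_{n-1}$. A starlike tree is a (finite) tree that has exactly one vertex of degree higher than $2$; that vertex is called the central vertex. *)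

theory Defs
  imports
    "Graph_Theory.Digraph_Component"
    "Jordan_Normal_Form.Spectral_Radius"
begin

text \<open>
  A finite simple undirected graph is a digraph satisfying the library locale \<^locale>\<open>graph\<close>: finite,
  symmetric, without loops or parallel arcs, so that each edge is a pair of opposite arcs and
  \<^const>\<open>out_degree\<close> is the usual vertex degree. For such graphs the library predicate
  \<^const>\<open>tree\<close> is unsuitable: its notion of cycle includes the closed walk u, v, u that runs along an
  edge and back. An undirected cycle has at least three arcs.
\<close>

definition undirected_tree :: "('a, 'b) pre_digraph \<Rightarrow> bool" where
  "undirected_tree G \<longleftrightarrow>
     graph G \<and> Digraph_Component.connected G \<and> \<not> (\<exists>p. pre_digraph.cycle G p \<and> 3 \<le> length p)"

definition central_vertex :: "('a, 'b) pre_digraph \<Rightarrow> 'a \<Rightarrow> bool" where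
  "central_vertex G v \<longleftrightarrow> v \<in> verts G \<and> 2 < out_degree G v"

definition starlike_tree :: "('a, 'b) pre_digraph \<Rightarrow> bool" where
  "starlike_tree G \<longleftrightarrow> undirected_tree G \<and> (\<exists>!v. central_vertex G v)"

text \<open>
  The list \<open>vs\<close> enumerates the vertices without repetition. Positions, and hence matrix and
  vector indices, start at 0.
\<close>

definition degree_matrix :: "('a, 'b) pre_digraph \<Rightarrow> 'a list \<Rightarrow> real mat" where
  "degree_matrix G vs = mat (length vs) (length vs)
     (\<lambda>(i, j). if i = j then real (out_degree G (vs ! i)) else 0)"

definition adjacency_matrix :: "('a, 'b) pre_digraph \<Rightarrow> 'a list \<Rightarrow> real mat" where
  "adjacency_matrix G vs = mat (length vs) (length vs)
     (\<lambda>(i, j). if vs ! i \<rightarrow>\<^bsub>G\<^esub> vs ! j then 1 else 0)"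

definition laplacian :: "('a, 'b) pre_digraph \<Rightarrow> 'a list \<Rightarrow> real mat" where
  "laplacian G vs = degree_matrix G vs - adjacency_matrix G vs"

end

theory Submission
  imports Defs
begin

text \<open>
  Let \<open>c\<close> be the central vertex, of degree \<open>d \<ge> 3\<close>, and let \<open>\<lambda>\<close> be the largest eigenvalue of the
  Laplacian \<open>L\<close>. At a vertex \<open>v\<close> the eigenvalue equation says that \<open>\<lambda> \<phi>(v)\<close> is the sum of the
  differences \<open>\<phi>(v) - \<phi>(u)\<close> over the neighbours \<open>u\<close> of \<open>v\<close>. If \<open>|\<phi>|\<close> attains its maximum \<open>M\<close> at \<open>v\<close>,
  each difference is at most \<open>2 M\<close>, so \<open>\<lambda> \<le> 2 deg v\<close>. A maximum at a non-central vertex therefore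
  forces \<open>\<lambda> \<le> 4\<close>.

  On the other hand \<open>\<lambda> \<ge> d + 1 \<ge> 4\<close>. By the Rayleigh principle (\<open>rayleigh_le_Max_spectrum\<close>) it suffices to
  test the quadratic form of \<open>L\<close> on the vector that is \<open>d\<close> at \<open>c\<close>, \<open>-1\<close> at the neighbours of \<open>c\<close>
  and \<open>0\<close> elsewhere: on the star with centre \<open>c\<close> this is the top eigenvector
  (\<open>Max_spectrum_ge_degree_Suc\<close>).

  Only \<open>\<lambda> = 4\<close>, \<open>d = 3\<close> remains. Then both estimates are equalities. Equality in the second makes the
  test vector an eigenvector, and its equation at a vertex at distance 2 from \<open>c\<close> would
  fail; so, the graph being connected, every other vertex is a neighbour of \<open>c\<close>
  (\<open>Max_spectrum_eq_degree_Suc_imp_dominating\<close>). Equality in the first says that a non-central vertex \<open>v\<close> with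
  \<open>|\<phi>(v)| = M\<close> has degree 2 and that both its neighbours carry the value \<open>-\<phi>(v)\<close>
  (\<open>eigenvector_peak\<close>). One neighbour of \<open>v\<close> is \<open>c\<close>; the other one, \<open>u\<close>, is also adjacent to \<open>c\<close> and
  is again a non-central maximum. Along the triangle \<open>c\<close>, \<open>v\<close>, \<open>u\<close> the sign of \<open>\<phi>\<close> would change
  three times, which is absurd since \<open>M > 0\<close>.
\<close>

section \<open>The largest eigenvalue of a real symmetric matrix\<close>

lemma scalar_prod_self_pos:
  fixes x :: "real vec"
  assumes "x \<in> carrier_vec n" and "x \<noteq> 0\<^sub>v n"
  shows "0 < x \<bullet> x"
proof -
  obtain i where i: "i < n" "x $ i \<noteq> 0"
    using assms by (metis carrier_vecD eq_vecI index_zero_vec)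
  have "(\<Sum>k = 0..<n. x $ k * x $ k) > 0"
    by (rule sum_pos2[of _ i]) (use i in \<open>auto simp: not_less less_le\<close>)
  then show ?thesis
    using assms(1) by (simp add: scalar_prod_def)
qed

lemma scalar_prod_self_nonneg:
  fixes x :: "real vec"
  shows "0 \<le> x \<bullet> x"
  by (simp add: scalar_prod_def sum_nonneg)

lemma symmetric_mat_scalar_prod_commute:
  fixes B :: "real mat"
  assumes B: "B \<in> carrier_mat n n" "transpose_mat B = B"
    and x: "x \<in> carrier_vec n" and y: "y \<in> carrier_vec n"
  shows "x \<bullet> (B *\<^sub>v y) = y \<bullet> (B *\<^sub>v x)"
proof -
  have "x \<bullet> (B *\<^sub>v y) = (B *\<^sub>v x) \<bullet> y"
    using transpose_vec_mult_scalar[OF B(1) y x] B(2) by simp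
  also have "\<dots> = y \<bullet> (B *\<^sub>v x)"
    by (rule comm_scalar_prod[of _ n]) (use assms in auto)
  finally show ?thesis .
qed

text \<open>
  The discriminant argument: the form is nonnegative on the line \<open>x + t y\<close>, hence a quadratic
  polynomial in \<open>t\<close> without sign change. As the form may be degenerate, the leading
  coefficient can vanish; then the linear coefficient has to vanish as well.
\<close>

lemma psd_cauchy_schwarz:
  fixes B :: "real mat"
  assumes B: "B \<in> carrier_mat n n" "transpose_mat B = B"
    and psd: "\<And>z. z \<in> carrier_vec n \<Longrightarrow> 0 \<le> z \<bullet> (B *\<^sub>v z)"
    and x: "x \<in> carrier_vec n" and y: "y \<in> carrier_vec n"
  shows "(x \<bullet> (B *\<^sub>v y))\<^sup>2 \<le> (x \<bullet> (B *\<^sub>v x)) * (y \<bullet> (B *\<^sub>v y))"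
proof -
  define a b c where "a = x \<bullet> (B *\<^sub>v x)" and "b = x \<bullet> (B *\<^sub>v y)" and "c = y \<bullet> (B *\<^sub>v y)"
  have Bx: "B *\<^sub>v x \<in> carrier_vec n" and By: "B *\<^sub>v y \<in> carrier_vec n"
    using B x y by auto
  have nonneg: "0 \<le> a + 2 * t * b + t\<^sup>2 * c" for t
  proof -
    have "B *\<^sub>v (x + t \<cdot>\<^sub>v y) = B *\<^sub>v x + t \<cdot>\<^sub>v (B *\<^sub>v y)"
      using B x y by (simp add: mult_add_distrib_mat_vec[of _ n n] mult_mat_vec[of _ n n])
    then have "(x + t \<cdot>\<^sub>v y) \<bullet> (B *\<^sub>v (x + t \<cdot>\<^sub>v y))
        = a + t * b + t * (y \<bullet> (B *\<^sub>v x)) + t * t * c"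
      using x y Bx By
      by (simp add: add_scalar_prod_distrib[of _ n] scalar_prod_add_distrib[of _ n]
          a_def b_def c_def algebra_simps)
    also have "y \<bullet> (B *\<^sub>v x) = b"
      using symmetric_mat_scalar_prod_commute[OF B y x] by (simp add: b_def)
    finally show ?thesis
      using psd[of "x + t \<cdot>\<^sub>v y"] x y by (simp add: power2_eq_square algebra_simps)
  qed
  have "b\<^sup>2 \<le> a * c"
  proof (cases "c = 0")
    case True
    have "b = 0"
    proof (rule ccontr)
      assume "b \<noteq> 0"
      \<comment> \<open>at this point the affine function \<open>a + 2 t b\<close> takes the value \<open>-1\<close>\<close>
      then show False
        using nonneg[of "- (a + 1) / (2 * b)"] True by (simp add: field_simps)
    qed
    with True show ?thesis by simp
  next
    case False
    then have "c > 0"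
      using psd[OF y] by (simp add: c_def)
    \<comment> \<open>the quadratic polynomial is least at \<open>t = - b / c\<close>\<close>
    then show ?thesis
      using nonneg[of "- b / c"] by (simp add: field_simps power2_eq_square)
  qed
  then show ?thesis
    by (simp add: a_def b_def c_def)
qed

text \<open>
  By Cauchy-Schwarz, a vector \<open>x\<close> on which the form vanishes is orthogonal to the image of \<open>B\<close>;
  by symmetry \<open>B x\<close> is then orthogonal to itself.
\<close>

lemma psd_form_zero_imp_kernel:
  fixes B :: "real mat"
  assumes B: "B \<in> carrier_mat n n" "transpose_mat B = B"
    and psd: "\<And>z. z \<in> carrier_vec n \<Longrightarrow> 0 \<le> z \<bullet> (B *\<^sub>v z)"
    and x: "x \<in> carrier_vec n" and zero: "x \<bullet> (B *\<^sub>v x) = 0"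
  shows "B *\<^sub>v x = 0\<^sub>v n"
proof (rule ccontr)
  assume ne: "B *\<^sub>v x \<noteq> 0\<^sub>v n"
  have Bx: "B *\<^sub>v x \<in> carrier_vec n"
    using B x by simp
  have "(x \<bullet> (B *\<^sub>v (B *\<^sub>v x)))\<^sup>2 \<le> 0"
    using psd_cauchy_schwarz[OF B psd x Bx] zero by simp
  then have "(B *\<^sub>v x) \<bullet> (B *\<^sub>v x) = 0"
    using symmetric_mat_scalar_prod_commute[OF B x Bx] by simp
  then show False
    using scalar_prod_self_pos[OF Bx ne] by simp
qed

lemma quadratic_form_bounded:
  fixes A :: "real mat"
  assumes A: "A \<in> carrier_mat n n"
  obtains K where "0 < K"
    and "\<And>x. x \<in> carrier_vec n \<Longrightarrow> x \<bullet> (A *\<^sub>v x) \<le> K * (x \<bullet> x)"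
proof
  let ?K = "1 + (\<Sum>i<n. \<Sum>j<n. \<bar>A $$ (i, j)\<bar>)"
  show "0 < ?K"
    by (intro add_pos_nonneg sum_nonneg) auto
  fix x :: "real vec"
  assume x: "x \<in> carrier_vec n"
  have sq: "(x $ i)\<^sup>2 \<le> x \<bullet> x" if "i < n" for i
  proof -
    have "x \<bullet> x = (\<Sum>k<n. (x $ k)\<^sup>2)"
      using x by (simp add: scalar_prod_def power2_eq_square atLeast0LessThan)
    then show ?thesis
      using that member_le_sum[of i "{..<n}" "\<lambda>k. (x $ k)\<^sup>2"] by simp
  qed
  have entry: "x $ i * (A $$ (i, j) * x $ j) \<le> \<bar>A $$ (i, j)\<bar> * (x \<bullet> x)"
    if "i < n" "j < n" for i j
  proof -
    have "2 * (\<bar>x $ i\<bar> * \<bar>x $ j\<bar>) \<le> (x $ i)\<^sup>2 + (x $ j)\<^sup>2"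
      using sum_squares_bound[of "\<bar>x $ i\<bar>" "\<bar>x $ j\<bar>"] by simp
    then have "\<bar>x $ i\<bar> * \<bar>x $ j\<bar> \<le> x \<bullet> x"
      using sq[OF that(1)] sq[OF that(2)] by linarith
    then have "\<bar>A $$ (i, j)\<bar> * (\<bar>x $ i\<bar> * \<bar>x $ j\<bar>) \<le> \<bar>A $$ (i, j)\<bar> * (x \<bullet> x)"
      by (intro mult_left_mono) auto
    moreover have "x $ i * (A $$ (i, j) * x $ j) \<le> \<bar>A $$ (i, j)\<bar> * (\<bar>x $ i\<bar> * \<bar>x $ j\<bar>)"
      using abs_ge_self[of "x $ i * (A $$ (i, j) * x $ j)"] by (simp add: abs_mult mult_ac)
    ultimately show ?thesis by linarith
  qed
  have "x \<bullet> (A *\<^sub>v x) = (\<Sum>i<n. \<Sum>j<n. x $ i * (A $$ (i, j) * x $ j))"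
    using A x by (simp add: scalar_prod_def sum_distrib_left atLeast0LessThan)
  also have "\<dots> \<le> (\<Sum>i<n. \<Sum>j<n. \<bar>A $$ (i, j)\<bar> * (x \<bullet> x))"
    by (intro sum_mono) (use entry in auto)
  also have "\<dots> \<le> ?K * (x \<bullet> x)"
    using scalar_prod_self_nonneg[of x] by (simp add: sum_distrib_right distrib_right)
  finally show "x \<bullet> (A *\<^sub>v x) \<le> ?K * (x \<bullet> x)" .
qed

lemma shifted_mat:
  fixes A :: "real mat"
  assumes A: "A \<in> carrier_mat n n" "transpose_mat A = A"
  shows shifted_carrier: "\<mu> \<cdot>\<^sub>m 1\<^sub>m n - A \<in> carrier_mat n n"
    and shifted_symmetric: "transpose_mat (\<mu> \<cdot>\<^sub>m 1\<^sub>m n - A) = \<mu> \<cdot>\<^sub>m 1\<^sub>m n - A"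
    and shifted_mult: "x \<in> carrier_vec n \<Longrightarrow> (\<mu> \<cdot>\<^sub>m 1\<^sub>m n - A) *\<^sub>v x = \<mu> \<cdot>\<^sub>v x - A *\<^sub>v x"
    and shifted_form: "x \<in> carrier_vec n \<Longrightarrow>
      x \<bullet> ((\<mu> \<cdot>\<^sub>m 1\<^sub>m n - A) *\<^sub>v x) = \<mu> * (x \<bullet> x) - x \<bullet> (A *\<^sub>v x)"
proof -
  show "\<mu> \<cdot>\<^sub>m 1\<^sub>m n - A \<in> carrier_mat n n"
    by (rule minus_carrier_mat[OF A(1)])
  show "transpose_mat (\<mu> \<cdot>\<^sub>m 1\<^sub>m n - A) = \<mu> \<cdot>\<^sub>m 1\<^sub>m n - A"
  proof (rule eq_matI)
    fix i j
    assume "i < dim_row (\<mu> \<cdot>\<^sub>m 1\<^sub>m n - A)" "j < dim_col (\<mu> \<cdot>\<^sub>m 1\<^sub>m n - A)"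
    then have ij: "i < n" "j < n"
      using A(1) by auto
    have "A $$ (j, i) = A $$ (i, j)"
      using arg_cong[OF A(2), of "\<lambda>M. M $$ (i, j)"] A(1) ij by simp
    then show "transpose_mat (\<mu> \<cdot>\<^sub>m 1\<^sub>m n - A) $$ (i, j) = (\<mu> \<cdot>\<^sub>m 1\<^sub>m n - A) $$ (i, j)"
      using A(1) ij by auto
  qed (use A(1) in auto)
  show mult: "(\<mu> \<cdot>\<^sub>m 1\<^sub>m n - A) *\<^sub>v x = \<mu> \<cdot>\<^sub>v x - A *\<^sub>v x" if x: "x \<in> carrier_vec n" for x
    using A(1) x by (intro eq_vecI)
      (auto simp: minus_mult_distrib_mat_vec[of _ n n] minus_scalar_prod_distrib[of _ n])
  show "x \<bullet> ((\<mu> \<cdot>\<^sub>m 1\<^sub>m n - A) *\<^sub>v x) = \<mu> * (x \<bullet> x) - x \<bullet> (A *\<^sub>v x)"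
    if x: "x \<in> carrier_vec n" for x
    using A x by (simp add: mult scalar_prod_minus_distrib[of _ n])
qed

text \<open>
  The supremum \<open>\<mu>\<close> of the Rayleigh quotients is an eigenvalue, which can be seen without a compactness
  argument. The form of \<open>B = \<mu> - A\<close> is positive semidefinite. If \<open>B\<close> had an inverse \<open>C\<close>, then
  Cauchy-Schwarz for \<open>z\<close> and \<open>w = C z\<close> would give
  \<open>(z \<bullet> z)\<^sup>2 \<le> (z \<bullet> B z) (w \<bullet> z)\<close>, and a bound \<open>L\<close> for the form of \<open>C\<close> would turn
  this into \<open>z \<bullet> z \<le> L (z \<bullet> B z)\<close>. All Rayleigh quotients of \<open>A\<close> would then be at most
  \<open>\<mu> - 1 / L\<close>, against the choice of \<open>\<mu>\<close>. Hence \<open>B\<close> is singular.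
\<close>

lemma rayleigh_le_Max_spectrum:
  fixes A :: "real mat"
  assumes A: "A \<in> carrier_mat n n" "transpose_mat A = A" and x: "x \<in> carrier_vec n"
  shows "x \<bullet> (A *\<^sub>v x) \<le> Max (spectrum A) * (x \<bullet> x)"
proof (cases "x = 0\<^sub>v n")
  case True
  then show ?thesis
    using A by simp
next
  case x0: False
  define S where "S = {(z \<bullet> (A *\<^sub>v z)) / (z \<bullet> z) | z. z \<in> carrier_vec n \<and> z \<noteq> 0\<^sub>v n}"
  define \<mu> where "\<mu> = Sup S"
  define B where "B = \<mu> \<cdot>\<^sub>m 1\<^sub>m n - A"
  note B = shifted_carrier[OF A, of \<mu>, folded B_def] shifted_symmetric[OF A, of \<mu>, folded B_def]
  have ne: "S \<noteq> {}"
    using x x0 by (auto simp: S_def)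
  obtain K where K: "\<And>z. z \<in> carrier_vec n \<Longrightarrow> z \<bullet> (A *\<^sub>v z) \<le> K * (z \<bullet> z)"
    using quadratic_form_bounded[OF A(1)] by metis
  have bdd: "bdd_above S"
    by (rule bdd_aboveI[of _ K])
      (auto simp: S_def divide_le_eq K scalar_prod_self_pos not_less scalar_prod_self_nonneg)
  have le_\<mu>: "z \<bullet> (A *\<^sub>v z) \<le> \<mu> * (z \<bullet> z)" if z: "z \<in> carrier_vec n" for z
  proof (cases "z = 0\<^sub>v n")
    case True
    then show ?thesis using A by simp
  next
    case False
    then have "(z \<bullet> (A *\<^sub>v z)) / (z \<bullet> z) \<le> \<mu>"
      unfolding \<mu>_def using z by (intro cSup_upper bdd) (auto simp: S_def)
    then show ?thesis
      using scalar_prod_self_pos[OF z False] by (simp add: divide_le_eq)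
  qed
  have psd: "0 \<le> z \<bullet> (B *\<^sub>v z)" if "z \<in> carrier_vec n" for z
    using shifted_form[OF A that] le_\<mu>[OF that] by (simp add: B_def)
  have "det B = 0"
  proof (rule ccontr)
    assume "det B \<noteq> 0"
    from det_non_zero_imp_unit[OF B(1) this, of "()"]
    obtain C where C: "C \<in> carrier_mat n n" "B * C = 1\<^sub>m n"
      by (auto simp: Units_def ring_mat_def)
    obtain L where L: "0 < L" "\<And>z. z \<in> carrier_vec n \<Longrightarrow> z \<bullet> (C *\<^sub>v z) \<le> L * (z \<bullet> z)"
      using quadratic_form_bounded[OF C(1)] by metis
    have "s \<le> \<mu> - 1 / L" if s_in: "s \<in> S" for s
    proof -
      obtain z where z: "z \<in> carrier_vec n" "z \<noteq> 0\<^sub>v n" and s: "s = (z \<bullet> (A *\<^sub>v z)) / (z \<bullet> z)"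
        using s_in by (auto simp: S_def)
      define w where "w = C *\<^sub>v z"
      have w: "w \<in> carrier_vec n"
        using C z by (simp add: w_def)
      have Bw: "B *\<^sub>v w = z"
        using B C z by (simp add: w_def flip: assoc_mult_mat_vec)
      have pos: "0 < z \<bullet> z"
        by (rule scalar_prod_self_pos[OF z])
      have wz: "w \<bullet> z \<le> L * (z \<bullet> z)"
        using L(2)[OF z(1)] comm_scalar_prod[OF w z(1)] by (simp add: w_def)
      have "(z \<bullet> z)\<^sup>2 \<le> (z \<bullet> (B *\<^sub>v z)) * (w \<bullet> z)"
        using psd_cauchy_schwarz[OF B psd z(1) w] Bw by simp
      also have "\<dots> \<le> (z \<bullet> (B *\<^sub>v z)) * (L * (z \<bullet> z))"
        by (rule mult_left_mono[OF wz psd[OF z(1)]])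
      finally have "z \<bullet> z \<le> L * (z \<bullet> (B *\<^sub>v z))"
        using pos by (simp add: power2_eq_square mult.assoc[symmetric] mult.commute)
      then have "z \<bullet> z \<le> L * (\<mu> * (z \<bullet> z) - z \<bullet> (A *\<^sub>v z))"
        using shifted_form[OF A z(1)] by (simp add: B_def)
      then show ?thesis
        using pos L(1) by (simp add: s field_simps)
    qed
    then have "\<mu> \<le> \<mu> - 1 / L"
      unfolding \<mu>_def by (intro cSup_least ne)
    then show False
      using L(1) by simp
  qed
  then obtain v where v: "v \<in> carrier_vec n" "v \<noteq> 0\<^sub>v n" "B *\<^sub>v v = 0\<^sub>v n"
    using det_0_iff_vec_prod_zero_field[OF B(1)] by auto
  have "A *\<^sub>v v = \<mu> \<cdot>\<^sub>v v"
  proof (rule eq_vecI)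
    fix i assume i: "i < dim_vec (\<mu> \<cdot>\<^sub>v v)"
    have "(\<mu> \<cdot>\<^sub>v v - A *\<^sub>v v) $ i = 0"
      using v i shifted_mult[OF A v(1), of \<mu>] by (simp add: B_def)
    then show "(A *\<^sub>v v) $ i = (\<mu> \<cdot>\<^sub>v v) $ i"
      using A v(1) i by simp
  qed (use A v in simp)
  then have "\<mu> \<in> spectrum A"
    using A v by (auto simp: spectrum_def eigenvalue_def eigenvector_def)
  then have "\<mu> \<le> Max (spectrum A)"
    using card_finite_spectrum(1)[OF A(1)] by simp
  then show ?thesis
    using le_\<mu>[OF x] mult_right_mono[OF _ scalar_prod_self_nonneg] order_trans by blast
qed

text \<open>
  With \<open>\<mu>\<close> the largest eigenvalue, \<open>\<mu> - A\<close> is positive semidefinite, and equality says that its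
  form vanishes at \<open>x\<close>.
\<close>

lemma rayleigh_eq_Max_imp_eigen:
  fixes A :: "real mat"
  assumes A: "A \<in> carrier_mat n n" "transpose_mat A = A" and x: "x \<in> carrier_vec n"
    and eq: "x \<bullet> (A *\<^sub>v x) = Max (spectrum A) * (x \<bullet> x)"
  shows "A *\<^sub>v x = Max (spectrum A) \<cdot>\<^sub>v x"
proof -
  let ?\<mu> = "Max (spectrum A)"
  have "(?\<mu> \<cdot>\<^sub>m 1\<^sub>m n - A) *\<^sub>v x = 0\<^sub>v n"
  proof (rule psd_form_zero_imp_kernel[OF shifted_carrier[OF A] shifted_symmetric[OF A] _ x])
    show "0 \<le> z \<bullet> ((?\<mu> \<cdot>\<^sub>m 1\<^sub>m n - A) *\<^sub>v z)" if "z \<in> carrier_vec n" for z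
      using rayleigh_le_Max_spectrum[OF A that] shifted_form[OF A that] by simp
    show "x \<bullet> ((?\<mu> \<cdot>\<^sub>m 1\<^sub>m n - A) *\<^sub>v x) = 0"
      using shifted_form[OF A x] eq by simp
  qed
  then have zero: "?\<mu> \<cdot>\<^sub>v x - A *\<^sub>v x = 0\<^sub>v n"
    using shifted_mult[OF A x] by simp
  show ?thesis
  proof (rule eq_vecI)
    fix i assume i: "i < dim_vec (?\<mu> \<cdot>\<^sub>v x)"
    have "(?\<mu> \<cdot>\<^sub>v x - A *\<^sub>v x) $ i = 0"
      using zero x i by simp
    then show "(A *\<^sub>v x) $ i = (?\<mu> \<cdot>\<^sub>v x) $ i"
      using A x i by simp
  qed (use A x in simp)
qed

section \<open>The Laplacian in an enumeration of the vertices\<close>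

text \<open>
  Vertices are represented by their positions in the enumeration, which are also the indices
  of matrices and vectors.
\<close>

locale enumerated_graph = graph G for G :: "('a, 'b) pre_digraph" +
  fixes vs :: "'a list"
  assumes distinct_vs: "distinct vs" and set_vs: "set vs = verts G"
begin

abbreviation n :: nat where "n \<equiv> length vs"
abbreviation L :: "real mat" where "L \<equiv> laplacian G vs"

definition nbrs :: "nat \<Rightarrow> nat set" where
  "nbrs i = {j. j < n \<and> vs ! i \<rightarrow>\<^bsub>G\<^esub> vs ! j}"

lemma finite_nbrs [simp]: "finite (nbrs i)"
  by (simp add: nbrs_def)

lemma nbrs_less: "j \<in> nbrs i \<Longrightarrow> j < n"
  by (simp add: nbrs_def)

lemma adj_sym: "u \<rightarrow>\<^bsub>G\<^esub> v \<Longrightarrow> v \<rightarrow>\<^bsub>G\<^esub> u"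
  using arcs_ends_symmetric[OF sym_arcs] by blast

lemma nbrs_sym: "j \<in> nbrs i \<Longrightarrow> i < n \<Longrightarrow> i \<in> nbrs j"
  using adj_sym by (simp add: nbrs_def)

lemma self_notin_nbrs: "i \<notin> nbrs i"
proof
  assume "i \<in> nbrs i"
  then obtain e where e: "e \<in> arcs G" "vs ! i = tail G e" "vs ! i = head G e"
    by (auto simp: nbrs_def arcs_ends_conv)
  then show False
    using no_loops[OF e(1)] by simp
qed

lemma out_degree_eq_card_nbrs:
  "out_degree G (vs ! i) = card (nbrs i)"
proof -
  have inj: "inj_on (head G) (out_arcs G (vs ! i))"
    by (rule inj_onI) (auto intro!: no_multi_arcs simp: arc_to_ends_def)
  have "head G ` out_arcs G (vs ! i) = (!) vs ` nbrs i"
  proof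
    show "head G ` out_arcs G (vs ! i) \<subseteq> (!) vs ` nbrs i"
    proof
      fix v assume "v \<in> head G ` out_arcs G (vs ! i)"
      then obtain e where e: "e \<in> arcs G" "tail G e = vs ! i" "v = head G e"
        by auto
      then have "vs ! i \<rightarrow>\<^bsub>G\<^esub> v"
        by (intro dominatesI[where a = e]) (auto simp: arc_to_ends_def)
      moreover have "v \<in> set vs"
        using e set_vs by simp
      ultimately show "v \<in> (!) vs ` nbrs i"
        by (auto simp: in_set_conv_nth nbrs_def)
    qed
    show "(!) vs ` nbrs i \<subseteq> head G ` out_arcs G (vs ! i)"
      by (auto simp: nbrs_def arcs_ends_conv)
  qed
  then have "out_degree G (vs ! i) = card ((!) vs ` nbrs i)"
    using card_image[OF inj] by (simp add: out_degree_def)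
  also have "\<dots> = card (nbrs i)"
    by (rule card_image, rule inj_on_nth[OF distinct_vs]) (auto simp: nbrs_def)
  finally show ?thesis .
qed

lemma laplacian_carrier: "L \<in> carrier_mat n n"
  unfolding laplacian_def degree_matrix_def adjacency_matrix_def
  by (intro minus_carrier_mat mat_carrier)

lemma laplacian_symmetric: "transpose_mat L = L"
  by (rule eq_matI) (auto simp: laplacian_def degree_matrix_def adjacency_matrix_def dest: adj_sym)

lemma laplacian_mult_vec:
  assumes x: "x \<in> carrier_vec n" and i: "i < n"
  shows "(L *\<^sub>v x) $ i = (\<Sum>j\<in>nbrs i. x $ i - x $ j)"
proof -
  have "(L *\<^sub>v x) $ i = (\<Sum>j<n. ((if i = j then real (card (nbrs i)) else 0)
      - (if j \<in> nbrs i then 1 else 0)) * x $ j)"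
    using x i
    by (auto simp: scalar_prod_def atLeast0LessThan laplacian_def degree_matrix_def
        adjacency_matrix_def out_degree_eq_card_nbrs nbrs_def intro!: sum.cong)
  also have "\<dots> = (\<Sum>j<n. if j = i then real (card (nbrs i)) * x $ j else 0)
      - (\<Sum>j<n. if j \<in> nbrs i then x $ j else 0)"
    unfolding sum_subtractf[symmetric] by (intro sum.cong) (auto simp: algebra_simps)
  also have "\<dots> = real (card (nbrs i)) * x $ i - (\<Sum>j\<in>nbrs i. x $ j)"
  proof -
    have "{..<n} \<inter> nbrs i = nbrs i"
      using nbrs_less by auto
    then show ?thesis
      using i by (simp flip: sum.inter_restrict)
  qed
  also have "\<dots> = (\<Sum>j\<in>nbrs i. x $ i - x $ j)"
    by (simp add: sum_subtractf)
  finally show ?thesis .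
qed

lemma connected_closed_set:
  assumes conn: "Digraph_Component.connected G"
    and c: "c \<in> S" "c < n"
    and closed: "\<And>k i. k \<in> S \<Longrightarrow> i \<in> nbrs k \<Longrightarrow> i \<in> S"
    and i: "i < n"
  shows "i \<in> S"
proof -
  have "vs ! c \<rightarrow>\<^sup>*\<^bsub>G\<^esub> vs ! i"
    using symmetric_connected_imp_strongly_connected[OF sym_arcs conn] nth_mem[OF c(2)] nth_mem[OF i]
    by (simp add: strongly_connected_def set_vs)
  then have "\<exists>j<n. vs ! j = vs ! i \<and> j \<in> S"
  proof (induction rule: reachable_induct)
    case base
    then show ?case using c by blast
  next
    case (step u v)
    then obtain j where j: "j < n" "vs ! j = u" "j \<in> S" by blast
    have "v \<in> set vs"
      using step(2) set_vs adj_in_verts(2) by simp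
    then obtain k where "k < n" "vs ! k = v"
      by (auto simp: in_set_conv_nth)
    with j step(2) closed[of j k] show ?case
      by (auto simp: nbrs_def)
  qed
  then show ?thesis
    using i distinct_vs nth_eq_iff_index_eq by blast
qed

section \<open>A vertex of degree d forces an eigenvalue of at least d + 1\<close>

text \<open>
  On the star formed by \<open>c\<close> and its neighbours, this is the eigenvector of the star's Laplacian for its
  largest eigenvalue \<open>d + 1\<close>; it is extended by zero.
\<close>

definition hub_vec :: "nat \<Rightarrow> real vec" where
  "hub_vec c = vec n (\<lambda>i. if i = c then real (card (nbrs c)) else if i \<in> nbrs c then - 1 else 0)"

lemma hub_vec_carrier: "hub_vec c \<in> carrier_vec n"
  by (simp add: hub_vec_def)

lemma hub_vec_nbr: "j \<in> nbrs c \<Longrightarrow> hub_vec c $ j = - 1"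
  using self_notin_nbrs nbrs_less by (auto simp: hub_vec_def)

lemma hub_vec_ge: "j < n \<Longrightarrow> - 1 \<le> hub_vec c $ j"
  by (simp add: hub_vec_def)

text \<open>
  The Rayleigh estimate for the test vector holds term by term. At \<open>c\<close> it is an equality. A neighbour
  of \<open>c\<close> contributes its difference \<open>-1 - d\<close> to \<open>c\<close>, and its differences to other
  vertices are at most \<open>0\<close> because \<open>-1\<close> is the least entry; multiplying by the entry \<open>-1\<close>
  turns the upper bound into the required lower bound.
\<close>

lemma hub_vec_pointwise:
  assumes c: "c < n" and i: "i < n"
  shows "(real (card (nbrs c)) + 1) * (hub_vec c $ i * hub_vec c $ i)
    \<le> hub_vec c $ i * (L *\<^sub>v hub_vec c) $ i"
proof -
  let ?d = "real (card (nbrs c))" and ?x = "hub_vec c"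
  have hub: "?x $ c = ?d"
    using c by (simp add: hub_vec_def)
  consider "i = c" | "i \<in> nbrs c" | "?x $ i = 0"
    using i by (cases "i = c"; cases "i \<in> nbrs c") (auto simp: hub_vec_def)
  then show ?thesis
  proof cases
    case 1
    have "(L *\<^sub>v ?x) $ c = (\<Sum>j\<in>nbrs c. ?d + 1)"
      unfolding laplacian_mult_vec[OF hub_vec_carrier c] using hub hub_vec_nbr
      by (intro sum.cong) auto
    then show ?thesis
      using 1 hub by (simp add: algebra_simps)
  next
    case 2
    then have c_nbr: "c \<in> nbrs i" and xi: "?x $ i = - 1"
      using nbrs_sym c hub_vec_nbr by auto
    have "(\<Sum>j\<in>nbrs i. ?x $ i - ?x $ j)
        = (?x $ i - ?x $ c) + (\<Sum>j\<in>nbrs i - {c}. ?x $ i - ?x $ j)"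
      by (rule sum.remove) (use c_nbr in auto)
    moreover have "(\<Sum>j\<in>nbrs i - {c}. ?x $ i - ?x $ j) \<le> 0"
      by (rule sum_nonpos) (use xi hub_vec_ge nbrs_less in auto)
    ultimately have "(L *\<^sub>v ?x) $ i \<le> - 1 - ?d"
      unfolding laplacian_mult_vec[OF hub_vec_carrier i] using xi hub by simp
    then show ?thesis
      using xi by simp
  next
    case 3
    then show ?thesis by simp
  qed
qed

lemma hub_vec_rayleigh:
  assumes c: "c < n"
  shows "(real (card (nbrs c)) + 1) * (hub_vec c \<bullet> hub_vec c) \<le> hub_vec c \<bullet> (L *\<^sub>v hub_vec c)"
proof -
  have dims: "dim_vec (hub_vec c) = n" "dim_vec (L *\<^sub>v hub_vec c) = n"
    using hub_vec_carrier laplacian_carrier by (auto simp: hub_vec_def)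
  show ?thesis
    unfolding scalar_prod_def dims sum_distrib_left
    by (intro sum_mono) (use hub_vec_pointwise[OF c] in auto)
qed

lemma Max_spectrum_ge_degree_Suc:
  assumes c: "c < n" and d: "nbrs c \<noteq> {}"
  shows "real (card (nbrs c)) + 1 \<le> Max (spectrum L)"
proof -
  have "hub_vec c $ c \<noteq> 0"
    using c d by (simp add: hub_vec_def card_eq_0_iff)
  then have "hub_vec c \<noteq> 0\<^sub>v n"
    using c by (metis index_zero_vec(1))
  then have "0 < hub_vec c \<bullet> hub_vec c"
    by (rule scalar_prod_self_pos[OF hub_vec_carrier])
  moreover have "(real (card (nbrs c)) + 1) * (hub_vec c \<bullet> hub_vec c)
      \<le> Max (spectrum L) * (hub_vec c \<bullet> hub_vec c)"
    using hub_vec_rayleigh[OF c]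
      rayleigh_le_Max_spectrum[OF laplacian_carrier laplacian_symmetric hub_vec_carrier[of c]]
    by linarith
  ultimately show ?thesis
    by simp
qed

text \<open>
  In the equality case the test vector is an eigenvector. Let \<open>m\<close> be a vertex outside the closed
  neighbourhood of \<open>c\<close>. The entry at \<open>m\<close> is \<open>0\<close>, and its neighbours, not being \<open>c\<close>, have
  entries at most \<open>0\<close>, so the equation at \<open>m\<close> makes these entries \<open>0\<close> and no neighbour of \<open>m\<close> is a
  neighbour of \<open>c\<close>. Thus the closed neighbourhood of \<open>c\<close> is closed under adjacency.
\<close>

lemma Max_spectrum_eq_degree_Suc_imp_dominating:
  assumes conn: "Digraph_Component.connected G" and c: "c < n"
    and eq: "Max (spectrum L) = real (card (nbrs c)) + 1"
    and i: "i < n" "i \<noteq> c"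
  shows "i \<in> nbrs c"
proof -
  let ?x = "hub_vec c"
  have eigen: "L *\<^sub>v ?x = Max (spectrum L) \<cdot>\<^sub>v ?x"
  proof (rule rayleigh_eq_Max_imp_eigen[OF laplacian_carrier laplacian_symmetric hub_vec_carrier])
    show "?x \<bullet> (L *\<^sub>v ?x) = Max (spectrum L) * (?x \<bullet> ?x)"
      using hub_vec_rayleigh[OF c] eq
        rayleigh_le_Max_spectrum[OF laplacian_carrier laplacian_symmetric hub_vec_carrier[of c]]
      by simp
  qed
  have closed: "m \<in> insert c (nbrs c)" if k: "k \<in> insert c (nbrs c)" and m: "m \<in> nbrs k" for k m
  proof (rule ccontr)
    assume far: "m \<notin> insert c (nbrs c)"
    have mn: "m < n"
      using m nbrs_less by simp
    have kc: "k \<in> nbrs c"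
      using k m far by auto
    have km: "k \<in> nbrs m"
      using nbrs_sym[OF m] kc nbrs_less by simp
    have c_far: "c \<notin> nbrs m"
      using far nbrs_sym mn by blast
    have xm: "?x $ m = 0"
      using far mn by (simp add: hub_vec_def)
    have nonneg: "0 \<le> ?x $ m - ?x $ j" if "j \<in> nbrs m" for j
      using that c_far xm nbrs_less[OF that] by (auto simp: hub_vec_def)
    have "(\<Sum>j\<in>nbrs m. ?x $ m - ?x $ j) = 0"
      using laplacian_mult_vec[OF hub_vec_carrier[of c] mn] eigen xm mn
      by (simp add: hub_vec_def)
    then have "?x $ m - ?x $ k = 0"
      using nonneg km sum_nonneg_eq_0_iff[of "nbrs m" "\<lambda>j. ?x $ m - ?x $ j"] by simp
    then show False
      using xm hub_vec_nbr[OF kc] by simp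
  qed
  have "i \<in> insert c (nbrs c)"
    by (rule connected_closed_set[OF conn _ c closed i(1)]) auto
  then show ?thesis
    using i by simp
qed

section \<open>The maximum principle at vertices of degree at most two\<close>

text \<open>
  The eigenvalue equation gives \<open>\<lambda> M \<le> 2 M deg i \<le> 4 M\<close> for the maximal modulus \<open>M > 0\<close>. Since
  \<open>\<lambda> \<ge> 4\<close>, all these are equalities, so every difference along an edge at \<open>i\<close> has the
  extreme modulus \<open>2 M\<close>.
\<close>

lemma eigenvector_peak:
  assumes \<phi>: "\<phi> \<in> carrier_vec n" and eigen: "L *\<^sub>v \<phi> = lam \<cdot>\<^sub>v \<phi>" and lam: "4 \<le> lam"
    and i: "i < n" and deg: "card (nbrs i) \<le> 2"
    and peak: "\<forall>k<n. \<bar>\<phi> $ k\<bar> \<le> \<bar>\<phi> $ i\<bar>" and pos: "0 < \<bar>\<phi> $ i\<bar>"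
  shows "lam = 4" and "card (nbrs i) = 2" and "j \<in> nbrs i \<Longrightarrow> \<phi> $ j = - \<phi> $ i"
proof -
  let ?M = "\<bar>\<phi> $ i\<bar>"
  have eq: "lam * \<phi> $ i = (\<Sum>j\<in>nbrs i. \<phi> $ i - \<phi> $ j)"
    using laplacian_mult_vec[OF \<phi> i] eigen \<phi> i by simp
  have bound: "\<bar>\<phi> $ i - \<phi> $ j\<bar> \<le> 2 * ?M" if "j \<in> nbrs i" for j
    using mp[OF spec[OF peak] nbrs_less[OF that]] by linarith
  have "lam * ?M = \<bar>\<Sum>j\<in>nbrs i. \<phi> $ i - \<phi> $ j\<bar>"
    using lam by (simp flip: eq add: abs_mult)
  also have "\<dots> \<le> (\<Sum>j\<in>nbrs i. \<bar>\<phi> $ i - \<phi> $ j\<bar>)"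
    by (rule sum_abs)
  finally have lower: "lam * ?M \<le> (\<Sum>j\<in>nbrs i. \<bar>\<phi> $ i - \<phi> $ j\<bar>)" .
  also have "\<dots> \<le> (\<Sum>j\<in>nbrs i. 2 * ?M)"
    by (rule sum_mono[OF bound])
  finally have "lam * ?M \<le> (2 * real (card (nbrs i))) * ?M"
    by simp
  then have le: "lam \<le> 2 * real (card (nbrs i))"
    using pos by simp
  show lam4: "lam = 4" and deg2: "card (nbrs i) = 2"
    using le lam deg by linarith+
  show "\<phi> $ j = - \<phi> $ i" if j: "j \<in> nbrs i"
  proof -
    have "(\<Sum>j\<in>nbrs i. 2 * ?M - \<bar>\<phi> $ i - \<phi> $ j\<bar>) \<le> 0"
      using lower lam4 deg2 by (simp add: sum_subtractf)
    moreover have "0 \<le> 2 * ?M - \<bar>\<phi> $ i - \<phi> $ j\<bar>" if "j \<in> nbrs i" for j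
      using bound[OF that] by simp
    ultimately have "2 * ?M - \<bar>\<phi> $ i - \<phi> $ j\<bar> = 0"
      using j sum_nonneg_eq_0_iff[of "nbrs i" "\<lambda>j. 2 * ?M - \<bar>\<phi> $ i - \<phi> $ j\<bar>"]
      by (simp add: sum_nonneg order_antisym)
    then show ?thesis
      using mp[OF spec[OF peak] nbrs_less[OF j]] by linarith
  qed
qed

text \<open>
  A maximum of the modulus away from the hub leads to the equality case of both estimates for the
  largest eigenvalue, and then to a triangle on which the sign of the eigenvector alternates.
\<close>

theorem top_eigenvector_peaks_at_hub:
  assumes conn: "Digraph_Component.connected G"
    and c: "c < n" and hub: "2 < card (nbrs c)"
    and others: "\<And>i. i < n \<Longrightarrow> i \<noteq> c \<Longrightarrow> card (nbrs i) \<le> 2"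
    and ev: "eigenvector L \<phi> (Max (spectrum L))"
    and j: "j < n" "j \<noteq> c"
  shows "\<bar>\<phi> $ j\<bar> < \<bar>\<phi> $ c\<bar>"
proof (rule ccontr)
  assume not_less: "\<not> \<bar>\<phi> $ j\<bar> < \<bar>\<phi> $ c\<bar>"
  have \<phi>: "\<phi> \<in> carrier_vec n" and \<phi>0: "\<phi> \<noteq> 0\<^sub>v n" and eigen: "L *\<^sub>v \<phi> = Max (spectrum L) \<cdot>\<^sub>v \<phi>"
    using ev laplacian_carrier by (auto simp: eigenvector_def)
  have ge: "real (card (nbrs c)) + 1 \<le> Max (spectrum L)"
    by (rule Max_spectrum_ge_degree_Suc[OF c]) (use hub in auto)
  then have lam: "4 \<le> Max (spectrum L)"
    using hub by linarith
  obtain i where i: "i < n" "i \<noteq> c" and max: "\<And>k. k < n \<Longrightarrow> k \<noteq> c \<Longrightarrow> \<bar>\<phi> $ k\<bar> \<le> \<bar>\<phi> $ i\<bar>"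
  proof -
    let ?S = "(\<lambda>k. \<bar>\<phi> $ k\<bar>) ` ({..<n} - {c})"
    have fin: "finite ?S" and "?S \<noteq> {}"
      using j by auto
    then have "Max ?S \<in> ?S"
      by (rule Max_in)
    then obtain i where "i < n" "i \<noteq> c" "Max ?S = \<bar>\<phi> $ i\<bar>" by auto
    moreover have "\<bar>\<phi> $ k\<bar> \<le> Max ?S" if "k < n" "k \<noteq> c" for k
      by (rule Max_ge[OF fin]) (use that in auto)
    ultimately show ?thesis
      by (intro that[of i]) auto
  qed
  \<comment> \<open>the assumed failure at \<open>j\<close> makes the largest modulus away from \<open>c\<close> a global maximum\<close>
  have peak: "\<forall>k<n. \<bar>\<phi> $ k\<bar> \<le> \<bar>\<phi> $ i\<bar>"
  proof (intro allI impI)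
    fix k assume "k < n"
    then show "\<bar>\<phi> $ k\<bar> \<le> \<bar>\<phi> $ i\<bar>"
      using max[of k] max[OF j] not_less by (cases "k = c") auto
  qed
  obtain k where "k < n" "\<phi> $ k \<noteq> 0"
    using \<phi> \<phi>0 by (metis carrier_vecD eq_vecI index_zero_vec)
  then have pos: "0 < \<bar>\<phi> $ i\<bar>"
    using spec[OF peak, of k] by auto
  note at_i = eigenvector_peak[OF \<phi> eigen lam i(1) others[OF i] peak pos]
  have "real (card (nbrs c)) + 1 = Max (spectrum L)"
    using at_i(1) ge hub by linarith
  then have dominating: "k \<in> nbrs c" if "k < n" "k \<noteq> c" for k
    using Max_spectrum_eq_degree_Suc_imp_dominating[OF conn c _ that] by simp
  have "\<not> nbrs i \<subseteq> {c}"
  proof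
    assume "nbrs i \<subseteq> {c}"
    then have "card (nbrs i) \<le> card {c}"
      by (intro card_mono) auto
    with at_i(2) show False by simp
  qed
  then obtain u where u: "u \<in> nbrs i" "u \<noteq> c" by auto
  have un: "u < n"
    using u nbrs_less by simp
  have \<phi>u: "\<phi> $ u = - \<phi> $ i"
    by (rule at_i(3)[OF u(1)])
  have \<phi>c: "\<phi> $ c = - \<phi> $ i"
    by (rule at_i(3), rule nbrs_sym[OF dominating[OF i] c])
  \<comment> \<open>\<open>u\<close> is a maximum as well, so the third edge of the triangle also flips the sign\<close>
  have "\<phi> $ c = - \<phi> $ u"
  proof (rule eigenvector_peak(3)[OF \<phi> eigen lam un others[OF un u(2)]])
    show "c \<in> nbrs u"
      by (rule nbrs_sym[OF dominating[OF un u(2)] c])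
    show "\<forall>k<n. \<bar>\<phi> $ k\<bar> \<le> \<bar>\<phi> $ u\<bar>" and "0 < \<bar>\<phi> $ u\<bar>"
      using peak pos unfolding \<phi>u abs_minus_cancel .
  qed
  then show False
    using \<phi>u \<phi>c pos by simp
qed

end

section \<open>Starlike trees\<close>

theorem theorem3p2:
  fixes T :: "('a, 'b) pre_digraph" and vs :: "'a list"
    and lam :: real and \<phi> :: "real Matrix.vec"
  assumes "starlike_tree T"
    and "distinct vs" and "set vs = verts T"
    and "central_vertex T (vs ! 0)"
    and "lam = Max (spectrum (laplacian T vs))"
    and "eigenvector (laplacian T vs) \<phi> lam"
  shows "\<forall>j\<in>{1..<length vs}. \<bar>\<phi> $ 0\<bar> > \<bar>\<phi> $ j\<bar>"
proof
  fix j assume j: "j \<in> {1..<length vs}"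
  have tree: "graph T" "Digraph_Component.connected T" and unique: "\<exists>!v. central_vertex T v"
    using assms(1) by (auto simp: starlike_tree_def undirected_tree_def)
  interpret enumerated_graph T vs
    using tree(1) assms(2,3) by (simp add: enumerated_graph_def enumerated_graph_axioms_def)
  have zero: "0 < n"
    using j by auto
  have others: "card (nbrs i) \<le> 2" if i: "i < n" "i \<noteq> 0" for i
  proof (rule ccontr)
    assume "\<not> card (nbrs i) \<le> 2"
    then have "central_vertex T (vs ! i)"
      using i set_vs by (auto simp: central_vertex_def out_degree_eq_card_nbrs)
    then have "vs ! i = vs ! 0"
      using unique assms(4) by blast
    then show False
      using i zero distinct_vs nth_eq_iff_index_eq by blast
  qed
  show "\<bar>\<phi> $ 0\<bar> > \<bar>\<phi> $ j\<bar>"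
  proof (rule top_eigenvector_peaks_at_hub[OF tree(2) zero _ others])
    show "2 < card (nbrs 0)"
      using assms(4) by (simp add: central_vertex_def out_degree_eq_card_nbrs)
    show "eigenvector L \<phi> (Max (spectrum L))"
      using assms(5,6) by simp
  qed (use j in auto)
qed

end
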